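(* Let $\mu=(\mu_r)_{r\in\mathcal{R}}$ satisfy the stability condition $\mu_r-\Lambda_r\ge\varepsilon$ for all $r\in\mathcal{R}$, let $s\in\{0,1\}^{\mathcal{A}}$ and let $S:=\{a\in\mathcal{A}: s_a=1\}$. Consider the following constraints in nonnegative auxiliary variables $\zeta_{ar}\ge0$ ($a\in\mathcal{A}$, $r\in\mathcal{R}$): $$\sum_{r\in\mathcal{R}}\pi_r\zeta_{ar}\le 1+(\alpha_a-1)s_a,\qquad \bigl(\zeta_{ar},\,s_a,\,-(\mu_r-\Lambda_r)(t_a^\star-t_a)\bigr)\in\mathcal{K}_{\exp},\qquad \forall a\in\mathcal{A},\ r\in\mathcal{R}.$$ These constraints impose the service-level requirement $\mathbb{P}(R_a\le t_a^\star)\ge 1-\alpha_a$ exactly for the elements of $S$; that is, there exist $\zeta_{ar}\ge 0$ satisfying them if and only if $\mathbb{P}(R_a\le t_a^\star)\ge1-\alpha_a$ for every $a\in S$ (no condition being imposed for $a\notin S$). Moreover, in the single-regime case $\mathcal{R}=\{1\}$, with $\alpha_a>0$ and $t_a^\star>t_a$ for all $a\in\mathcal{A}$, the stability condition $\mu_1-\Lambda_1\ge\varepsilon$ together with the existence of $\zeta_{a1}\ge0$ ($a\in\mathcal{A}$) such that $\pi_1\zeta_{a1}\le 1+(\alpha_a-1)s_a$ and $\bigl(\zeta_{a1},\,s_a,\,-(\mu_1-\Lambda_1)(t_a^\star-t_a)\bigr)\in\mathcal{K}_{\exp}$ for all $a\in\mathcal{A}$ is equivalent to $$\mu_1\ \ge\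 \left(\max\left\{\varepsilon,\,-\frac{\log(\alpha_a)}{t_a^\star-t_a}\right\}-\varepsilon\right)s_a+\Lambda_1+\varepsilon,\qquad\forall a\in\mathcal{A}.$$
   Context: $\mathcal{A}$ is a finite nonempty set of demand points and $\mathcal{R}$ a finite nonempty set of regimes. Data: $\varepsilon>0$; arrival rates $\Lambda_r\ge0$ with $\sum_r\Lambda_r>0$; $\pi_r=\Lambda_r/\sum_{r'}\Lambda_{r'}$; access times $t_a\ge0$; thresholds $t_a^\star\ge t_a$; tolerances $\alpha_a\in[0,1]$. The exponential cone is $$\mathcal{K}_{\exp}=\{(x,y,z)\in\mathbb{R}^3: x\ge y e^{z/y},\ y>0\}\cup\{(x,0,z)\in\mathbb{R}^3: z\le 0\le x\}.$$ $R_a$ is the total response time of a customer from demand point $a$: $R_a=t_a+T$, where the customer is routed to regime $r$ with probability $\pi_r$ and, conditional on regime $r$, $T$ is the stationary sojourn time (waiting plus service) in a stable first-come first-served $\mathrm{M}/\mathrm{M}/1$ queue with arrival rate $\Lambda_r$ and service rate $\mu_r>\Lambda_r$. *)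

theory Defs
  imports "HOL-Probability.Probability"
begin

definition K_exp :: "(real \<times> real \<times> real) set" where
  "K_exp = {(x, y, z) | x y z. x \<ge> y * exp (z / y) \<and> y > 0}
         \<union> {(x, 0, z) | x z. z \<le> 0 \<and> 0 \<le> x}"

definition regime_prob :: "'r set \<Rightarrow> ('r \<Rightarrow> real) \<Rightarrow> 'r \<Rightarrow> real" where
  "regime_prob \<R> \<Lambda> r = \<Lambda> r / (\<Sum>r'\<in>\<R>. \<Lambda> r')"

definition exponential_law :: "real \<Rightarrow> real measure" where
  "exponential_law l = density lborel (\<lambda>x. ennreal (exponential_density l x))"

(* In a first-come first-served single-server queue, let x be the sojourn time of a customer,
   u the time until the next arrival and v the service time of that next customer.  The next
   customer then waits for max 0 (x - u) and has sojourn time max 0 (x - u) + v (Lindley's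
   recursion).  In an M/M/1 queue, u and v are exponential with rates lam and m, independent
   of each other and of x.  A stationary law of the sojourn time is an invariant law of the
   resulting Markov chain.  Only arrival rates lam > 0 are meaningful here. *)
definition mm1_sojourn_step :: "real \<Rightarrow> real \<Rightarrow> real measure \<Rightarrow> real measure" where
  "mm1_sojourn_step lam m \<tau> =
     distr (\<tau> \<Otimes>\<^sub>M (exponential_law lam \<Otimes>\<^sub>M exponential_law m)) borel
       (\<lambda>(x, u, v). max 0 (x - u) + v)"

definition mm1_stationary_sojourn :: "real \<Rightarrow> real \<Rightarrow> real measure \<Rightarrow> bool" where
  "mm1_stationary_sojourn lam m \<tau> \<longleftrightarrow>
     prob_space \<tau> \<and> sets \<tau> = sets borel \<and> mm1_sojourn_step lam m \<tau> = \<tau>"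

(* X is the total response time of a customer with access time ta.  Conditioning on the routing
   event {Reg = r} is done with uniform_measure, and only for regimes of positive probability
   (equivalently, of positive arrival rate). *)
definition is_response_time ::
  "'w measure \<Rightarrow> 'r set \<Rightarrow> ('r \<Rightarrow> real) \<Rightarrow> ('r \<Rightarrow> real) \<Rightarrow> real \<Rightarrow> ('w \<Rightarrow> real) \<Rightarrow> bool" where
  "is_response_time M \<R> \<Lambda> \<mu> ta X \<longleftrightarrow>
     (\<exists>Reg T. Reg \<in> measurable M (count_space \<R>) \<and> T \<in> borel_measurable M \<and>
        (\<forall>\<omega>\<in>space M. X \<omega> = ta + T \<omega>) \<and>
        (\<forall>r\<in>\<R>. measure M {\<omega> \<in> space M. Reg \<omega> = r} = regime_prob \<R> \<Lambda> r \<and>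
          (regime_prob \<R> \<Lambda> r > 0 \<longrightarrow>
             mm1_stationary_sojourn (\<Lambda> r) (\<mu> r)
               (distr (uniform_measure M {\<omega> \<in> space M. Reg \<omega> = r}) borel T))))"

end

theory Submission
  imports Defs
begin

text \<open>A cone constraint with second coordinate \<open>1\<close> says \<open>exp z \<le> \<zeta>\<close>, and one with second coordinate
  \<open>0\<close> is harmless when \<open>z \<le> 0 \<le> \<zeta>\<close>.  So the constraints for a demand point with \<open>s = 0\<close> are solved
  by \<open>\<zeta> = 0\<close>, while for \<open>s = 1\<close> the cheapest \<open>\<zeta>\<close> is the exponential itself and what remains is
  \<open>(\<Sum>r. \<pi> r * exp (- (\<mu> r - \<Lambda> r) * (t_star - t))) \<le> \<alpha>\<close> (\<open>ex_cone_certificate_iff\<close>).  The left-hand side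
  is the probability that the response time exceeds \<open>t_star\<close>, because in every regime that occurs
  with positive probability the sojourn time is exponential with rate \<open>\<mu> r - \<Lambda> r\<close>
  (\<open>response_time_cdf\<close>).  With one regime, \<open>\<pi> = 1\<close> and taking logarithms gives the linear bound.

  The substance is that \<^emph>\<open>every\<close> invariant law of the Lindley recursion is this exponential law
  (\<open>mm1_stationary_sojourn_cdf\<close>).  Let \<open>X\<close> have an invariant law with distribution function \<open>F\<close>, let
  \<open>U\<close> and \<open>V\<close> be the interarrival and service times, with rates \<open>l < m\<close>, and let \<open>G\<close> be the
  distribution function of the waiting time \<open>W = max 0 (X - U)\<close>.  On \<open>[0, \<infinity>)\<close> one has
  \<open>G w = E (F (w + U))\<close>, because \<open>W \<le> w\<close> iff \<open>X \<le> w + U\<close>, and invariance means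
  \<open>F y = E (G (y - V); V \<le> y)\<close>.  Since \<open>U\<close> and \<open>V\<close> are exponential, these two identities are integral
  equations that make \<open>F\<close> and \<open>G\<close> first continuous, then differentiable, with
  \<open>F' = m (G - F)\<close> and \<open>G' = l (G - F)\<close>.
  So \<open>G - F\<close> is a multiple of \<open>exp (- (m - l) x)\<close>, and \<open>F 0 = 0\<close> together with \<open>F \<rightarrow> 1\<close> at infinity
  determines \<open>F\<close>.\<close>

section \<open>Averaging against an exponential law\<close>

lemma prob_space_exponential_law: "0 < l \<Longrightarrow> prob_space (exponential_law l)"
  unfolding exponential_law_def by (rule prob_space_exponential_density)

lemma sets_exponential_law [measurable_cong]: "sets (exponential_law l) = sets borel"
  by (simp add: exponential_law_def)

lemma integral_exponential_law:
  fixes f :: "real \<Rightarrow> real"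
  assumes "0 < l" and [measurable]: "f \<in> borel_measurable borel"
  shows "(\<integral>u. f u \<partial>exponential_law l) = (\<integral>u. indicator {0..} u * (l * exp (- (l * u)) * f u) \<partial>lborel)"
proof -
  have "(\<integral>u. f u \<partial>exponential_law l) = (\<integral>u. exponential_density l u * f u \<partial>lborel)"
    unfolding exponential_law_def
    using assms by (intro integral_real_density) (auto simp: exponential_density_def)
  also have "\<dots> = (\<integral>u. indicator {0..} u * (l * exp (- (l * u)) * f u) \<partial>lborel)"
    by (intro Bochner_Integration.integral_cong)
       (auto simp: exponential_density_def indicator_def mult.commute)
  finally show ?thesis .
qed

text \<open>For \<open>w \<ge> 0\<close> and \<open>F\<close> the distribution function of \<open>X\<close>, this is the probability of
  \<open>max 0 (X - U) \<le> w\<close>, where \<open>U\<close> is independent of \<open>X\<close> and exponential with rate \<open>l\<close>.  For \<open>w < 0\<close> it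
  is only a monotone extension, convenient because monotone functions are Borel measurable.\<close>

definition waiting_cdf :: "real \<Rightarrow> (real \<Rightarrow> real) \<Rightarrow> real \<Rightarrow> real" where
  "waiting_cdf l F w = (\<integral>u. F (w + u) \<partial>exponential_law l)"

text \<open>The part of being a distribution function that passes from \<open>F\<close> to \<open>waiting_cdf l F\<close> by monotonicity
  of the integral alone.  It is enough to have all the integrals below.\<close>

locale bounded_mono =
  fixes F :: "real \<Rightarrow> real"
  assumes mono: "mono F" and nonneg: "\<And>x. 0 \<le> F x" and le_1: "\<And>x. F x \<le> 1"
begin

lemma measurable_F [measurable]: "F \<in> borel_measurable borel"
  using mono by (rule borel_measurable_mono)

lemma integrable_shift:
  assumes "0 < l"
  shows "integrable (exponential_law l) (\<lambda>u. F (w + u))"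
proof -
  interpret prob_space "exponential_law l" using assms by (rule prob_space_exponential_law)
  show ?thesis
    by (rule integrable_const_bound[where B = 1]) (auto simp: nonneg le_1)
qed

lemma bounded_mono_waiting_cdf:
  assumes "0 < l"
  shows "bounded_mono (waiting_cdf l F)"
proof
  interpret E: prob_space "exponential_law l" using assms by (rule prob_space_exponential_law)
  show "mono (waiting_cdf l F)"
    unfolding waiting_cdf_def
    by (intro monoI integral_mono integrable_shift assms monoD[OF mono]) auto
  show "0 \<le> waiting_cdf l F x" for x
    unfolding waiting_cdf_def by (simp add: nonneg)
  have "waiting_cdf l F x \<le> (\<integral>u. 1 \<partial>exponential_law l)" for x
    unfolding waiting_cdf_def
    by (intro integral_mono integrable_shift assms) (auto simp: le_1)
  then show "waiting_cdf l F x \<le> 1" for x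
    by (simp add: E.prob_space)
qed

lemma set_integrable_exp:
  fixes c d :: real
  shows "set_integrable lborel {a..b} (\<lambda>y. d * exp (c * y) * F y)"
proof -
  have "set_integrable lborel {a..b} (\<lambda>y. d * exp (c * y))"
    by (intro borel_integrable_atLeastAtMost' continuous_intros)
  then show ?thesis
    unfolding set_integrable_def
  proof (rule Bochner_Integration.integrable_bound)
    show "AE x in lborel. norm (indicator {a..b} x *\<^sub>R (d * exp (c * x) * F x))
        \<le> norm (indicator {a..b} x *\<^sub>R (d * exp (c * x)))"
      using nonneg le_1 by (auto simp: indicator_def abs_mult intro!: AE_I2 mult_left_le)
  qed simp
qed

text \<open>Substituting \<open>y = w + u\<close> turns \<open>exp (- l * w) * waiting_cdf l F w\<close> into the integral of
  \<open>l * exp (- l * y) * F y\<close> over \<open>[w, \<infinity>)\<close>.  Writing this as the integral over \<open>[0, \<infinity>)\<close> minus that over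
  \<open>[0, w]\<close> leaves only integrals over compact intervals, to which the fundamental theorem of
  calculus applies.\<close>

lemma waiting_cdf_integral_equation:
  assumes l: "0 < l" and w: "0 \<le> w"
  shows "exp (- l * w) * waiting_cdf l F w
    = waiting_cdf l F 0 - integral {0..w} (\<lambda>y. l * exp (- l * y) * F y)"
proof -
  let ?h = "\<lambda>y. l * exp (- l * y) * F y"
  have tail: "exp (- l * v) * waiting_cdf l F v = (LINT y:{v..}|lborel. ?h y)" for v
  proof -
    have "exp (- l * v) * waiting_cdf l F v
        = exp (- l * v) * (\<integral>u. indicator {0..} u * (l * exp (- (l * u)) * F (v + u)) \<partial>lborel)"
      unfolding waiting_cdf_def by (subst integral_exponential_law[OF l]) auto
    also have "\<dots> = (\<integral>u. exp (- l * v) * (indicator {0..} u * (l * exp (- (l * u)) * F (v + u))) \<partial>lborel)"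
      by simp
    also have "\<dots> = (\<integral>u. indicator {v..} (v + 1 * u) * ?h (v + 1 * u) \<partial>lborel)"
      by (intro Bochner_Integration.integral_cong)
         (auto simp: indicator_def exp_add[symmetric] algebra_simps)
    also have "\<dots> = (\<integral>y. indicator {v..} y * ?h y \<partial>lborel)"
      using lborel_integral_real_affine[of 1 "\<lambda>y. indicator {v..} y * ?h y" v] by simp
    finally show ?thesis by (simp add: set_lebesgue_integral_def)
  qed
  have int0: "set_integrable lborel {0..} ?h"
  proof -
    have "integrable lborel (\<lambda>u. exponential_density l u * F u)"
      using integrable_shift[OF l, of 0] l unfolding exponential_law_def
      by (subst (asm) integrable_real_density) (auto simp: exponential_density_def)
    then show ?thesis
      unfolding set_integrable_def
      by (rule Bochner_Integration.integrable_cong[THEN iffD1, rotated 2])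
         (auto simp: exponential_density_def indicator_def mult.commute)
  qed
  have "(LINT y:{0..}|lborel. ?h y) = (LINT y:{0..<w} \<union> {w..}|lborel. ?h y)"
    using w by (intro arg_cong2[where f = "\<lambda>A. set_lebesgue_integral lborel A"]) auto
  also have "\<dots> = (LINT y:{0..<w}|lborel. ?h y) + (LINT y:{w..}|lborel. ?h y)"
    by (intro set_integral_Un set_integrable_subset[OF int0]) (use w in auto)
  also have "(LINT y:{0..<w}|lborel. ?h y) = (LINT y:{0..w}|lborel. ?h y)"
    unfolding set_lebesgue_integral_def
  proof (rule integral_cong_AE)
    show "AE y in lborel. indicator {0..<w} y *\<^sub>R ?h y = indicator {0..w} y *\<^sub>R ?h y"
      using AE_lborel_singleton[of w] by eventually_elim (auto simp: indicator_def)
  qed simp_all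
  also have "\<dots> = integral {0..w} ?h"
    by (rule set_borel_integral_eq_integral(2)[OF set_integrable_exp])
  finally show ?thesis
    using tail[of w] tail[of 0] by simp
qed

end

section \<open>The stationary sojourn time of an M/M/1 queue\<close>

text \<open>The probability of \<open>max 0 (x - u) + v \<le> y\<close> is computed by integrating out \<open>x\<close> first: for \<open>v \<le> y\<close> the
  event is \<open>x \<le> y - v + u\<close>, of probability \<open>F (y - v + u)\<close>, and for \<open>v > y\<close> it is empty.
  Integrating out \<open>u\<close> next produces \<open>waiting_cdf l F (y - v)\<close>, and the substitution \<open>w = y - v\<close> in the
  last integral gives the second equation.\<close>

lemma sojourn_cdf_integral_equations:
  assumes l: "0 < l" and m: "0 < m" and st: "mm1_stationary_sojourn l m \<tau>"
  defines "F \<equiv> cdf \<tau>"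
  shows "bounded_mono F"
    and "\<And>y. 0 \<le> y \<Longrightarrow> exp (m * y) * F y = integral {0..y} (\<lambda>w. m * exp (m * w) * waiting_cdf l F w)"
proof -
  interpret \<tau>: prob_space \<tau> using st by (simp add: mm1_stationary_sojourn_def)
  interpret L: prob_space "exponential_law l" using l by (rule prob_space_exponential_law)
  interpret N: prob_space "exponential_law m" using m by (rule prob_space_exponential_law)
  interpret LN: pair_prob_space "exponential_law l" "exponential_law m" ..
  interpret P: pair_prob_space \<tau> "exponential_law l \<Otimes>\<^sub>M exponential_law m" ..
  have sets_\<tau> [measurable_cong]: "sets \<tau> = sets borel"
    and inv: "mm1_sojourn_step l m \<tau> = \<tau>"
    using st by (auto simp: mm1_stationary_sojourn_def)
  then have space_\<tau> [simp]: "space \<tau> = UNIV"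
    using sets_eq_imp_space_eq by force
  show bm: "bounded_mono F"
    by standard (auto simp: F_def cdf_def intro!: monoI \<tau>.finite_measure_mono)
  interpret bounded_mono F by fact
  let ?G = "waiting_cdf l F"
  interpret G: bounded_mono ?G using bounded_mono_waiting_cdf[OF l] .
  have sp [simp]: "space (exponential_law k) = UNIV" for k
    by (simp add: exponential_law_def)
  fix y :: real assume y: "0 \<le> y"
  have "ennreal (F y) = emeasure (mm1_sojourn_step l m \<tau>) {..y}"
    by (simp add: inv F_def cdf_def \<tau>.emeasure_eq_measure)
  also have "\<dots> = emeasure (\<tau> \<Otimes>\<^sub>M (exponential_law l \<Otimes>\<^sub>M exponential_law m))
      {p. max 0 (fst p - fst (snd p)) + snd (snd p) \<le> y}"
    unfolding mm1_sojourn_step_def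
    by (subst emeasure_distr) (auto simp: space_pair_measure case_prod_beta intro!: arg_cong2[where f = emeasure])
  also have "\<dots> = (\<integral>\<^sup>+p. emeasure \<tau> ((\<lambda>x. (x, p)) -` {p. max 0 (fst p - fst (snd p)) + snd (snd p) \<le> y})
      \<partial>(exponential_law l \<Otimes>\<^sub>M exponential_law m))"
  proof (rule P.emeasure_pair_measure_alt2)
    have "{p \<in> space (\<tau> \<Otimes>\<^sub>M (exponential_law l \<Otimes>\<^sub>M exponential_law m)).
        max 0 (fst p - fst (snd p)) + snd (snd p) \<le> y}
        \<in> sets (\<tau> \<Otimes>\<^sub>M (exponential_law l \<Otimes>\<^sub>M exponential_law m))"
      by measurable
    then show "{p. max 0 (fst p - fst (snd p)) + snd (snd p) \<le> y}
        \<in> sets (\<tau> \<Otimes>\<^sub>M (exponential_law l \<Otimes>\<^sub>M exponential_law m))"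
      by (simp add: space_pair_measure)
  qed
  also have "\<dots> = (\<integral>\<^sup>+p. indicator {..y} (snd p) * ennreal (F (y - snd p + fst p))
      \<partial>(exponential_law l \<Otimes>\<^sub>M exponential_law m))"
  proof (rule nn_integral_cong)
    fix p :: "real \<times> real"
    have "(\<lambda>x. (x, p)) -` {p. max 0 (fst p - fst (snd p)) + snd (snd p) \<le> y}
        = (if snd p \<le> y then {..y - snd p + fst p} else {})"
      by (auto simp: max_def split: if_splits)
    then show "emeasure \<tau> ((\<lambda>x. (x, p)) -` {p. max 0 (fst p - fst (snd p)) + snd (snd p) \<le> y})
        = indicator {..y} (snd p) * ennreal (F (y - snd p + fst p))"
      by (simp add: F_def cdf_def \<tau>.emeasure_eq_measure)
  qed
  also have "\<dots> = (\<integral>\<^sup>+v. \<integral>\<^sup>+u. indicator {..y} v * ennreal (F (y - v + u))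
      \<partial>exponential_law l \<partial>exponential_law m)"
    by (subst LN.nn_integral_snd[symmetric]) auto
  also have "\<dots> = (\<integral>\<^sup>+v. ennreal (indicator {..y} v * ?G (y - v)) \<partial>exponential_law m)"
    unfolding waiting_cdf_def using integrable_shift[OF l]
    by (intro nn_integral_cong)
       (auto simp: nn_integral_cmult nn_integral_eq_integral nonneg indicator_def)
  also have "\<dots> = ennreal (\<integral>v. indicator {..y} v * ?G (y - v) \<partial>exponential_law m)"
    by (intro nn_integral_eq_integral N.integrable_const_bound[where B = 1])
       (auto simp: G.nonneg G.le_1 indicator_def)
  finally have "F y = (\<integral>v. indicator {..y} v * ?G (y - v) \<partial>exponential_law m)"
    by (subst (asm) ennreal_inj) (auto simp: nonneg G.nonneg)
  also have "\<dots> = (\<integral>v. indicator {0..} v * (m * exp (- (m * v)) * (indicator {..y} v * ?G (y - v))) \<partial>lborel)"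
    by (rule integral_exponential_law[OF m]) simp
  finally have "exp (m * y) * F y
      = (\<integral>v. exp (m * y) * (indicator {0..} v * (m * exp (- (m * v)) * (indicator {..y} v * ?G (y - v)))) \<partial>lborel)"
    by simp
  also have "\<dots> = (\<integral>v. indicator {0..y} (y + (-1) * v) * (m * exp (m * (y + (-1) * v)) * ?G (y + (-1) * v)) \<partial>lborel)"
    by (intro Bochner_Integration.integral_cong)
       (auto simp: indicator_def right_diff_distrib exp_diff exp_minus divide_simps)
  also have "\<dots> = (\<integral>w. indicator {0..y} w * (m * exp (m * w) * ?G w) \<partial>lborel)"
    using lborel_integral_real_affine[of "-1" "\<lambda>w. indicator {0..y} w * (m * exp (m * w) * ?G w)" y]
    by simp
  also have "\<dots> = (LINT w:{0..y}|lborel. m * exp (m * w) * ?G w)"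
    by (simp add: set_lebesgue_integral_def)
  also have "\<dots> = integral {0..y} (\<lambda>w. m * exp (m * w) * ?G w)"
    by (rule set_borel_integral_eq_integral(2)[OF G.set_integrable_exp])
  finally show "exp (m * y) * F y = integral {0..y} (\<lambda>w. m * exp (m * w) * ?G w)" .
qed

text \<open>Each integral equation expresses one of \<open>F\<close> and \<open>G\<close> through a smooth factor and an indefinite
  integral involving the other.  An indefinite integral is continuous, so \<open>F\<close> and \<open>G\<close> are; the integrands are then
  continuous, so \<open>F\<close> and \<open>G\<close> are differentiable.  The condition \<open>l < m\<close> enters when \<open>x \<rightarrow> \<infinity>\<close>: the
  exponential must vanish there for the total mass to fix the constant.\<close>

proposition mm1_stationary_sojourn_cdf:
  assumes l: "0 < l" and lm: "l < m" and st: "mm1_stationary_sojourn l m \<tau>" and x: "0 \<le> x"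
  shows "cdf \<tau> x = 1 - exp (- (m - l) * x)"
proof -
  have m: "0 < m" using l lm by simp
  define F where "F = cdf \<tau>"
  define G where "G = waiting_cdf l F"
  interpret F: bounded_mono F
    using sojourn_cdf_integral_equations(1)[OF l m st] unfolding F_def .
  interpret G: bounded_mono G
    unfolding G_def by (rule F.bounded_mono_waiting_cdf[OF l])
  have F_eq: "F y = exp (- m * y) * integral {0..y} (\<lambda>w. m * exp (m * w) * G w)" if "0 \<le> y" for y
    using sojourn_cdf_integral_equations(2)[OF l m st that] 
    unfolding F_def G_def by (simp add: exp_minus field_simps)
  have G_eq: "G y = exp (l * y) * (G 0 - integral {0..y} (\<lambda>w. l * exp (- l * w) * F w))" if "0 \<le> y" for y
    using F.waiting_cdf_integral_equation[OF l that]
    unfolding G_def by (simp add: exp_minus field_simps)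
  have F0: "F 0 = 0" using F_eq[of 0] by simp
  have sol: "F y = m * G 0 / (m - l) * (1 - exp (- (m - l) * y))" if y: "0 \<le> y" for y
  proof -
    have "continuous_on {0..y} (\<lambda>z. exp (- m * z) * integral {0..z} (\<lambda>w. m * exp (m * w) * G w))"
      by (intro continuous_intros indefinite_integral_continuous_1
          set_borel_integral_eq_integral(1)[OF G.set_integrable_exp])
    then have contF: "continuous_on {0..y} F"
      by (rule continuous_on_eq) (simp add: F_eq)
    have "continuous_on {0..y} (\<lambda>z. exp (l * z) * (G 0 - integral {0..z} (\<lambda>w. l * exp (- l * w) * F w)))"
      by (intro continuous_intros indefinite_integral_continuous_1
          set_borel_integral_eq_integral(1)[OF F.set_integrable_exp])
    then have contG: "continuous_on {0..y} G"
      by (rule continuous_on_eq) (metis G_eq atLeastAtMost_iff)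
    have dF: "(F has_real_derivative m * (G z - F z)) (at z within {0..y})" if z: "z \<in> {0..y}" for z
    proof -
      have "((\<lambda>z. integral {0..z} (\<lambda>w. m * exp (m * w) * G w)) has_real_derivative m * exp (m * z) * G z)
          (at z within {0..y})"
        using z by (intro integral_has_real_derivative continuous_intros contG)
      moreover have "((\<lambda>z. exp (- m * z)) has_real_derivative - m * exp (- m * z)) (at z within {0..y})"
        by (auto intro!: derivative_eq_intros)
      ultimately have "((\<lambda>z. exp (- m * z) * integral {0..z} (\<lambda>w. m * exp (m * w) * G w))
          has_real_derivative - m * exp (- m * z) * integral {0..z} (\<lambda>w. m * exp (m * w) * G w)
            + m * exp (m * z) * G z * exp (- m * z)) (at z within {0..y})"
        by (rule DERIV_mult[rotated])
      also have "- m * exp (- m * z) * integral {0..z} (\<lambda>w. m * exp (m * w) * G w)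
          + m * exp (m * z) * G z * exp (- m * z) = m * (G z - F z)"
        using z by (subst F_eq) (auto simp: exp_minus field_simps)
      finally show ?thesis
        by (rule has_field_derivative_transform_within[OF _ zero_less_one z]) (simp add: F_eq)
    qed
    have dG: "(G has_real_derivative l * (G z - F z)) (at z within {0..y})" if z: "z \<in> {0..y}" for z
    proof -
      have "((\<lambda>z. integral {0..z} (\<lambda>w. l * exp (- l * w) * F w)) has_real_derivative l * exp (- l * z) * F z)
          (at z within {0..y})"
        using z by (intro integral_has_real_derivative continuous_intros contF)
      then have "((\<lambda>z. G 0 - integral {0..z} (\<lambda>w. l * exp (- l * w) * F w))
          has_real_derivative 0 - l * exp (- l * z) * F z) (at z within {0..y})"
        by (intro DERIV_diff DERIV_const)
      moreover have "((\<lambda>z. exp (l * z)) has_real_derivative l * exp (l * z)) (at z within {0..y})"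
        by (auto intro!: derivative_eq_intros)
      ultimately have "((\<lambda>z. exp (l * z) * (G 0 - integral {0..z} (\<lambda>w. l * exp (- l * w) * F w)))
          has_real_derivative l * exp (l * z) * (G 0 - integral {0..z} (\<lambda>w. l * exp (- l * w) * F w))
            + (0 - l * exp (- l * z) * F z) * exp (l * z)) (at z within {0..y})"
        by (rule DERIV_mult[rotated])
      also have "l * exp (l * z) * (G 0 - integral {0..z} (\<lambda>w. l * exp (- l * w) * F w))
          + (0 - l * exp (- l * z) * F z) * exp (l * z) = l * (G z - F z)"
        using z by (subst (2) G_eq) (auto simp: exp_minus field_simps)
      finally show ?thesis
        by (rule has_field_derivative_transform_within[OF _ zero_less_one z]) (metis G_eq atLeastAtMost_iff)
    qed
    \<comment> \<open>\<open>(G - F)' = - (m - l) * (G - F)\<close>, so the integrating factor makes the product constant; its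
      value at \<open>0\<close> is \<open>G 0\<close>, the probability of not having to wait.\<close>
    have D: "exp ((m - l) * z) * (G z - F z) = G 0" if z: "z \<in> {0..y}" for z
    proof -
      have "\<exists>c. \<forall>z\<in>{0..y}. exp ((m - l) * z) * (G z - F z) = c"
      proof (rule has_field_derivative_zero_constant)
        fix z assume z: "z \<in> {0..y}"
        show "((\<lambda>z. exp ((m - l) * z) * (G z - F z)) has_field_derivative 0) (at z within {0..y})"
          by (auto intro!: derivative_eq_intros dF[OF z] dG[OF z] simp: algebra_simps)
      qed simp
      then obtain c where c: "\<And>z. z \<in> {0..y} \<Longrightarrow> exp ((m - l) * z) * (G z - F z) = c" by blast
      show ?thesis using c[OF z] c[of 0] y F0 by simp
    qed
    have D': "G z - F z = exp (- (m - l) * z) * G 0" if "z \<in> {0..y}" for z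
      using D[OF that] by (simp add: exp_minus exp_diff field_simps)
    \<comment> \<open>Hence \<open>F' = m * G 0 * exp (- (m - l) * z)\<close>, whose antiderivative is known.\<close>
    have "\<exists>c. \<forall>z\<in>{0..y}. F z - m * G 0 / (m - l) * (1 - exp (- (m - l) * z)) = c"
    proof (rule has_field_derivative_zero_constant)
      fix z assume z: "z \<in> {0..y}"
      show "((\<lambda>z. F z - m * G 0 / (m - l) * (1 - exp (- (m - l) * z))) has_field_derivative 0)
          (at z within {0..y})"
        using lm by (auto intro!: derivative_eq_intros dF[OF z] simp: D'[OF z] field_simps)
    qed simp
    then obtain c where
      c: "\<And>z. z \<in> {0..y} \<Longrightarrow> F z - m * G 0 / (m - l) * (1 - exp (- (m - l) * z)) = c"
      by blast
    show ?thesis using c[of 0] c[of y] y F0 by simp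
  qed
  interpret real_distribution \<tau>
    using st by (simp add: mm1_stationary_sojourn_def real_distribution_def real_distribution_axioms_def)
  have "(F \<longlongrightarrow> 1) at_top"
    unfolding F_def by (rule cdf_lim_at_top_prob)
  moreover have "(F \<longlongrightarrow> m * G 0 / (m - l) * (1 - 0)) at_top"
  proof (rule Lim_transform_eventually)
    have "((\<lambda>y. exp (- (m - l) * y)) \<longlongrightarrow> 0) at_top"
      using lm by real_asymp
    then show "((\<lambda>y. m * G 0 / (m - l) * (1 - exp (- (m - l) * y))) \<longlongrightarrow> m * G 0 / (m - l) * (1 - 0)) at_top"
      by (intro tendsto_intros)
    show "\<forall>\<^sub>F y in at_top. m * G 0 / (m - l) * (1 - exp (- (m - l) * y)) = F y"
      using eventually_ge_at_top[of 0] by eventually_elim (simp add: sol)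
  qed
  ultimately have "m * G 0 / (m - l) = 1"
    using tendsto_unique[of at_top F] by force
  then show ?thesis
    using sol[OF x] unfolding F_def by simp
qed

section \<open>The response time as a mixture over regimes\<close>

lemma sum_regime_prob:
  "(\<Sum>r\<in>\<R>. \<Lambda> r) \<noteq> 0 \<Longrightarrow> (\<Sum>r\<in>\<R>. regime_prob \<R> \<Lambda> r) = 1"
  by (simp add: regime_prob_def sum_divide_distrib[symmetric])

text \<open>Total probability over the regimes.  A regime with \<open>\<Lambda> r = 0\<close> has routing probability \<open>0\<close>, so
  nothing is known about the sojourn time in it, but it contributes \<open>0\<close> to both sides.  In all other
  regimes the conditional law of the sojourn time is stationary and hence exponential.\<close>

proposition response_time_cdf:
  assumes "finite \<R>" and \<Lambda>: "\<forall>r\<in>\<R>. 0 \<le> \<Lambda> r" "0 < (\<Sum>r\<in>\<R>. \<Lambda> r)"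
    and stable: "\<forall>r\<in>\<R>. \<Lambda> r < \<mu> r"
    and M: "prob_space M" and X: "is_response_time M \<R> \<Lambda> \<mu> ta X" and "ta \<le> x"
  shows "measure M {\<omega> \<in> space M. X \<omega> \<le> x}
    = 1 - (\<Sum>r\<in>\<R>. regime_prob \<R> \<Lambda> r * exp (- (\<mu> r - \<Lambda> r) * (x - ta)))"
proof -
  interpret prob_space M by fact
  let ?\<pi> = "regime_prob \<R> \<Lambda>"
  from X obtain Reg T where Reg [measurable]: "Reg \<in> measurable M (count_space \<R>)"
    and T [measurable]: "T \<in> borel_measurable M"
    and XT: "\<And>\<omega>. \<omega> \<in> space M \<Longrightarrow> X \<omega> = ta + T \<omega>"
    and prob_Reg: "\<And>r. r \<in> \<R> \<Longrightarrow> measure M {\<omega> \<in> space M. Reg \<omega> = r} = ?\<pi> r"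
    and st: "\<And>r. r \<in> \<R> \<Longrightarrow> 0 < ?\<pi> r \<Longrightarrow> mm1_stationary_sojourn (\<Lambda> r) (\<mu> r)
               (distr (uniform_measure M {\<omega> \<in> space M. Reg \<omega> = r}) borel T)"
    unfolding is_response_time_def by blast
  define A where "A r = {\<omega> \<in> space M. Reg \<omega> = r}" for r
  define B where "B = {\<omega> \<in> space M. T \<omega> \<le> x - ta}"
  have A [measurable]: "A r \<in> sets M" if "r \<in> \<R>" for r
  proof -
    have "Reg -` {r} \<inter> space M \<in> sets M" using that by (intro measurable_sets[OF Reg]) auto
    then show ?thesis unfolding A_def by (simp add: vimage_def Int_def conj_commute)
  qed
  have B [measurable]: "B \<in> sets M" unfolding B_def by measurable
  have joint: "measure M (A r \<inter> B) = ?\<pi> r * (1 - exp (- (\<mu> r - \<Lambda> r) * (x - ta)))" if r: "r \<in> \<R>" for r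
  proof (cases "0 < ?\<pi> r")
    case True
    then have "0 < \<Lambda> r"
      using \<Lambda> by (simp add: regime_prob_def zero_less_divide_iff)
    then have "1 - exp (- (\<mu> r - \<Lambda> r) * (x - ta)) = cdf (distr (uniform_measure M (A r)) borel T) (x - ta)"
      using mm1_stationary_sojourn_cdf[OF _ _ st[OF r True]] stable r \<open>ta \<le> x\<close> unfolding A_def by simp
    also have "\<dots> = measure (uniform_measure M (A r)) B"
      unfolding cdf_def by (subst measure_distr) (auto simp: B_def vimage_def Int_def conj_commute)
    also have "\<dots> = measure M (A r \<inter> B) / ?\<pi> r"
      using True prob_Reg[OF r] A[OF r] B
      by (subst measure_uniform_measure) (auto simp: A_def emeasure_eq_measure)
    finally show ?thesis using True by (simp add: field_simps)
  next
    case False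
    then have "?\<pi> r = 0" using prob_Reg[OF r] by (metis measure_nonneg less_eq_real_def)
    moreover have "measure M (A r \<inter> B) \<le> measure M (A r)"
      using A[OF r] by (intro finite_measure_mono) auto
    ultimately show ?thesis using prob_Reg[OF r] by (simp add: A_def measure_le_0_iff)
  qed
  have "{\<omega> \<in> space M. X \<omega> \<le> x} = (\<Union>r\<in>\<R>. A r \<inter> B)"
    using measurable_space[OF Reg] XT unfolding A_def B_def by fastforce
  then have "measure M {\<omega> \<in> space M. X \<omega> \<le> x} = measure M (\<Union>r\<in>\<R>. A r \<inter> B)" by simp
  also have "\<dots> = (\<Sum>r\<in>\<R>. measure M (A r \<inter> B))"
    using A B \<open>finite \<R>\<close>
    by (intro finite_measure_finite_Union) (auto simp: disjoint_family_on_def A_def)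
  also have "\<dots> = (\<Sum>r\<in>\<R>. ?\<pi> r) - (\<Sum>r\<in>\<R>. ?\<pi> r * exp (- (\<mu> r - \<Lambda> r) * (x - ta)))"
    by (simp add: joint right_diff_distrib sum_subtractf)
  finally show ?thesis using \<Lambda>(2) by (simp add: sum_regime_prob)
qed

section \<open>Constraints in the exponential cone\<close>

lemma K_exp_1_iff: "(x, 1, z) \<in> K_exp \<longleftrightarrow> exp z \<le> x"
  by (auto simp: K_exp_def)

lemma K_exp_0_iff: "(x, 0, z) \<in> K_exp \<longleftrightarrow> z \<le> 0 \<and> 0 \<le> x"
  by (auto simp: K_exp_def)

text \<open>For \<open>s = 1\<close> the cone puts the lower bound \<open>exp (z r)\<close> on each \<open>\<zeta> r\<close>; the weights are nonnegative, so
  the bound itself is the best choice.  For \<open>s = 0\<close> the zero vector is feasible, which is where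
  \<open>z \<le> 0\<close> is needed.\<close>

lemma ex_cone_certificate_iff:
  assumes "\<forall>r\<in>\<R>. 0 \<le> p r" and "\<forall>r\<in>\<R>. z r \<le> 0" and "s = 0 \<or> s = 1"
  shows "(\<exists>\<zeta>. (\<forall>r\<in>\<R>. 0 \<le> \<zeta> r) \<and> (\<Sum>r\<in>\<R>. p r * \<zeta> r) \<le> 1 + (\<alpha> - 1) * s \<and>
             (\<forall>r\<in>\<R>. (\<zeta> r, s, z r) \<in> K_exp))
    \<longleftrightarrow> (s = 1 \<longrightarrow> (\<Sum>r\<in>\<R>. p r * exp (z r)) \<le> \<alpha>)"
  (is "(\<exists>\<zeta>. ?C \<zeta>) \<longleftrightarrow> _")
  using assms(3)
proof (elim disjE)
  assume s: "s = 0"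
  then have "?C (\<lambda>_. 0)" using assms(2) by (simp add: K_exp_0_iff)
  then have "\<exists>\<zeta>. ?C \<zeta>" by (rule exI[where P = "\<lambda>\<zeta>. ?C \<zeta>"])
  with s show ?thesis by simp
next
  assume s: "s = 1"
  show ?thesis
  proof
    assume "\<exists>\<zeta>. ?C \<zeta>"
    then obtain \<zeta> where "\<forall>r\<in>\<R>. exp (z r) \<le> \<zeta> r" "(\<Sum>r\<in>\<R>. p r * \<zeta> r) \<le> \<alpha>"
      using s by (auto simp: K_exp_1_iff)
    moreover from this(1) have "(\<Sum>r\<in>\<R>. p r * exp (z r)) \<le> (\<Sum>r\<in>\<R>. p r * \<zeta> r)"
      using assms(1) by (intro sum_mono mult_left_mono) auto
    ultimately show "s = 1 \<longrightarrow> (\<Sum>r\<in>\<R>. p r * exp (z r)) \<le> \<alpha>" by simp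
  next
    assume "s = 1 \<longrightarrow> (\<Sum>r\<in>\<R>. p r * exp (z r)) \<le> \<alpha>"
    then have "?C (\<lambda>r. exp (z r))" using s by (simp add: K_exp_1_iff)
    then show "\<exists>\<zeta>. ?C \<zeta>" by (rule exI[where P = "\<lambda>\<zeta>. ?C \<zeta>"])
  qed
qed

section \<open>Service-level requirements and their conic form\<close>

theorem lemma1:
  fixes \<A> :: "'a set" and \<R> :: "'r set"
    and \<epsilon> :: real
    and \<Lambda> \<mu> :: "'r \<Rightarrow> real"
    and t t_star \<alpha> s :: "'a \<Rightarrow> real"
    and M :: "'w measure" and R :: "'a \<Rightarrow> 'w \<Rightarrow> real"
  assumes "finite \<A>" "\<A> \<noteq> {}" "finite \<R>" "\<R> \<noteq> {}"
    and "\<epsilon> > 0"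
    and "\<forall>r\<in>\<R>. \<Lambda> r \<ge> 0" "(\<Sum>r\<in>\<R>. \<Lambda> r) > 0"
    and "\<forall>a\<in>\<A>. t a \<ge> 0" "\<forall>a\<in>\<A>. t_star a \<ge> t a"
    and "\<forall>a\<in>\<A>. \<alpha> a \<in> {0..1}"
    and "\<forall>a\<in>\<A>. s a \<in> {0, 1}"
  shows "((\<forall>r\<in>\<R>. \<mu> r - \<Lambda> r \<ge> \<epsilon>) \<and>
          prob_space M \<and> (\<forall>a\<in>\<A>. is_response_time M \<R> \<Lambda> \<mu> (t a) (R a)) \<longrightarrow>
          ((\<exists>\<zeta> :: 'a \<Rightarrow> 'r \<Rightarrow> real.
              (\<forall>a\<in>\<A>. \<forall>r\<in>\<R>. \<zeta> a r \<ge> 0) \<and>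
              (\<forall>a\<in>\<A>. (\<Sum>r\<in>\<R>. regime_prob \<R> \<Lambda> r * \<zeta> a r) \<le> 1 + (\<alpha> a - 1) * s a) \<and>
              (\<forall>a\<in>\<A>. \<forall>r\<in>\<R>. (\<zeta> a r, s a, - (\<mu> r - \<Lambda> r) * (t_star a - t a)) \<in> K_exp))
           \<longleftrightarrow>
           (\<forall>a \<in> {a \<in> \<A>. s a = 1}.
              measure M {\<omega> \<in> space M. R a \<omega> \<le> t_star a} \<ge> 1 - \<alpha> a)))
       \<and>
         (\<forall>r1. \<R> = {r1} \<and> (\<forall>a\<in>\<A>. \<alpha> a > 0 \<and> t_star a > t a) \<longrightarrow>
          ((\<mu> r1 - \<Lambda> r1 \<ge> \<epsilon> \<and>
            (\<exists>\<zeta> :: 'a \<Rightarrow> real.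
               (\<forall>a\<in>\<A>. \<zeta> a \<ge> 0) \<and>
               (\<forall>a\<in>\<A>. regime_prob \<R> \<Lambda> r1 * \<zeta> a \<le> 1 + (\<alpha> a - 1) * s a) \<and>
               (\<forall>a\<in>\<A>. (\<zeta> a, s a, - (\<mu> r1 - \<Lambda> r1) * (t_star a - t a)) \<in> K_exp)))
           \<longleftrightarrow>
           (\<forall>a\<in>\<A>. \<mu> r1 \<ge>
              (max \<epsilon> (- (ln (\<alpha> a) / (t_star a - t a))) - \<epsilon>) * s a + \<Lambda> r1 + \<epsilon>)))"
proof (intro conjI impI allI)
  assume H: "(\<forall>r\<in>\<R>. \<mu> r - \<Lambda> r \<ge> \<epsilon>) \<and> prob_space M \<and>
    (\<forall>a\<in>\<A>. is_response_time M \<R> \<Lambda> \<mu> (t a) (R a))"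
  let ?\<pi> = "regime_prob \<R> \<Lambda>" and ?z = "\<lambda>a r. - (\<mu> r - \<Lambda> r) * (t_star a - t a)"
  let ?C = "\<lambda>a \<zeta>. (\<forall>r\<in>\<R>. 0 \<le> \<zeta> r) \<and> (\<Sum>r\<in>\<R>. ?\<pi> r * \<zeta> r) \<le> 1 + (\<alpha> a - 1) * s a \<and>
    (\<forall>r\<in>\<R>. (\<zeta> r, s a, ?z a r) \<in> K_exp)"
  have "(\<exists>\<zeta>. ?C a \<zeta>) \<longleftrightarrow> (s a = 1 \<longrightarrow> 1 - \<alpha> a \<le> measure M {\<omega> \<in> space M. R a \<omega> \<le> t_star a})"
    if a: "a \<in> \<A>" for a
  proof -
    have "measure M {\<omega> \<in> space M. R a \<omega> \<le> t_star a} = 1 - (\<Sum>r\<in>\<R>. ?\<pi> r * exp (?z a r))"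
      using H assms a by (intro response_time_cdf) fastforce+
    moreover have "(\<exists>\<zeta>. ?C a \<zeta>) \<longleftrightarrow> (s a = 1 \<longrightarrow> (\<Sum>r\<in>\<R>. ?\<pi> r * exp (?z a r)) \<le> \<alpha> a)"
    proof (rule ex_cone_certificate_iff)
      show "\<forall>r\<in>\<R>. 0 \<le> ?\<pi> r"
        using assms(6,7) by (simp add: regime_prob_def)
      have "0 \<le> (\<mu> r - \<Lambda> r) * (t_star a - t a)" if "r \<in> \<R>" for r
        using H assms(5,9) a that by (intro mult_nonneg_nonneg) fastforce+
      then show "\<forall>r\<in>\<R>. ?z a r \<le> 0" by (simp only: mult_minus_left neg_le_0_iff_le) blast
      show "s a = 0 \<or> s a = 1" using assms(11) a by auto
    qed
    ultimately show ?thesis by auto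
  qed
  then have "(\<forall>a\<in>\<A>. \<exists>\<zeta>. ?C a \<zeta>) \<longleftrightarrow>
      (\<forall>a\<in>{a \<in> \<A>. s a = 1}. 1 - \<alpha> a \<le> measure M {\<omega> \<in> space M. R a \<omega> \<le> t_star a})"
    by blast
  \<comment> \<open>No constraint couples different demand points, so \<open>\<zeta>\<close> can be chosen pointwise.\<close>
  moreover have "(\<forall>a\<in>\<A>. \<exists>\<zeta>. ?C a \<zeta>) \<longleftrightarrow> (\<exists>\<zeta>. \<forall>a\<in>\<A>. ?C a (\<zeta> a))"
    by (rule bchoice_iff)
  ultimately show "(\<exists>\<zeta> :: 'a \<Rightarrow> 'r \<Rightarrow> real.
        (\<forall>a\<in>\<A>. \<forall>r\<in>\<R>. \<zeta> a r \<ge> 0) \<and>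
        (\<forall>a\<in>\<A>. (\<Sum>r\<in>\<R>. ?\<pi> r * \<zeta> a r) \<le> 1 + (\<alpha> a - 1) * s a) \<and>
        (\<forall>a\<in>\<A>. \<forall>r\<in>\<R>. (\<zeta> a r, s a, ?z a r) \<in> K_exp))
     \<longleftrightarrow> (\<forall>a\<in>{a \<in> \<A>. s a = 1}. measure M {\<omega> \<in> space M. R a \<omega> \<le> t_star a} \<ge> 1 - \<alpha> a)"
    by (simp only: ball_conj_distrib)
next
  fix r1
  assume H: "\<R> = {r1} \<and> (\<forall>a\<in>\<A>. \<alpha> a > 0 \<and> t_star a > t a)"
  let ?\<pi> = "regime_prob \<R> \<Lambda> r1" and ?z = "\<lambda>a. - (\<mu> r1 - \<Lambda> r1) * (t_star a - t a)"
  let ?C = "\<lambda>a \<zeta>. 0 \<le> \<zeta> \<and> ?\<pi> * \<zeta> \<le> 1 + (\<alpha> a - 1) * s a \<and> (\<zeta>, s a, ?z a) \<in> K_exp"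
  let ?bound = "\<lambda>a. (max \<epsilon> (- (ln (\<alpha> a) / (t_star a - t a))) - \<epsilon>) * s a + \<Lambda> r1 + \<epsilon>"
  have \<pi>: "?\<pi> = 1"
    using H assms(7) by (simp add: regime_prob_def)
  have "\<mu> r1 - \<Lambda> r1 \<ge> \<epsilon> \<and> (\<exists>\<zeta>. ?C a \<zeta>) \<longleftrightarrow> \<mu> r1 \<ge> ?bound a" if a: "a \<in> \<A>" for a
  proof (cases "\<mu> r1 - \<Lambda> r1 \<ge> \<epsilon>")
    case True
    have d: "0 < t_star a - t a" and \<alpha>: "0 < \<alpha> a" and s: "s a = 0 \<or> s a = 1"
      using H a assms(11) by auto
    have "(\<exists>\<zeta>. ?C a \<zeta>) \<longleftrightarrow> (s a = 1 \<longrightarrow> exp (?z a) \<le> \<alpha> a)"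
    proof -
      have "0 \<le> (\<mu> r1 - \<Lambda> r1) * (t_star a - t a)"
        using True assms(5) d by (intro mult_nonneg_nonneg) auto
      then have "?z a \<le> 0" by (simp only: mult_minus_left neg_le_0_iff_le)
      then have "(\<exists>\<zeta>. (\<forall>r\<in>{r1}. 0 \<le> \<zeta> r) \<and> (\<Sum>r\<in>{r1}. 1 * \<zeta> r) \<le> 1 + (\<alpha> a - 1) * s a \<and>
            (\<forall>r\<in>{r1}. (\<zeta> r, s a, ?z a) \<in> K_exp)) \<longleftrightarrow> (s a = 1 \<longrightarrow> (\<Sum>r\<in>{r1}. 1 * exp (?z a)) \<le> \<alpha> a)"
        using s by (intro ex_cone_certificate_iff) auto
      moreover have "(\<exists>\<zeta>::'r \<Rightarrow> real. ?C a (\<zeta> r1)) \<longleftrightarrow> (\<exists>\<zeta>. ?C a \<zeta>)"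
        by (rule iffI; elim exE; rule exI[of _ "\<lambda>_. _"] exI; assumption)
      ultimately show ?thesis using \<pi> by simp
    qed
    also have "exp (?z a) \<le> \<alpha> a \<longleftrightarrow> - (\<mu> r1 - \<Lambda> r1) * (t_star a - t a) \<le> ln (\<alpha> a)"
      by (rule ln_ge_iff[OF \<alpha>, symmetric])
    also have "\<dots> \<longleftrightarrow> - (\<mu> r1 - \<Lambda> r1) \<le> ln (\<alpha> a) / (t_star a - t a)"
      by (rule pos_le_divide_eq[OF d, symmetric])
    also have "\<dots> \<longleftrightarrow> - (ln (\<alpha> a) / (t_star a - t a)) \<le> \<mu> r1 - \<Lambda> r1"
      by linarith
    finally show ?thesis using True s by auto
  next
    case False
    \<comment> \<open>The coefficient of \<open>s a\<close> is nonnegative, so the linear bound already contains stability.\<close>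
    have "0 \<le> (max \<epsilon> (- (ln (\<alpha> a) / (t_star a - t a))) - \<epsilon>) * s a"
      using assms(11) a by fastforce
    then show ?thesis using False by auto
  qed
  \<comment> \<open>Recovering stability from the bounds takes at least one demand point.\<close>
  then have "\<mu> r1 - \<Lambda> r1 \<ge> \<epsilon> \<and> (\<forall>a\<in>\<A>. \<exists>\<zeta>. ?C a \<zeta>) \<longleftrightarrow> (\<forall>a\<in>\<A>. \<mu> r1 \<ge> ?bound a)"
    using assms(2) by blast
  moreover have "(\<forall>a\<in>\<A>. \<exists>\<zeta>. ?C a \<zeta>) \<longleftrightarrow> (\<exists>\<zeta>. \<forall>a\<in>\<A>. ?C a (\<zeta> a))"
    by (rule bchoice_iff)
  ultimately show "(\<mu> r1 - \<Lambda> r1 \<ge> \<epsilon> \<and>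
      (\<exists>\<zeta> :: 'a \<Rightarrow> real. (\<forall>a\<in>\<A>. \<zeta> a \<ge> 0) \<and>
         (\<forall>a\<in>\<A>. ?\<pi> * \<zeta> a \<le> 1 + (\<alpha> a - 1) * s a) \<and>
         (\<forall>a\<in>\<A>. (\<zeta> a, s a, ?z a) \<in> K_exp)))
     \<longleftrightarrow> (\<forall>a\<in>\<A>. \<mu> r1 \<ge> ?bound a)"
    by (simp only: ball_conj_distrib)
qed

end
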